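(* Let $G$ be a finitely generated group and $X\subset A^G$ a subshift. Then $X$ has topological strong spatial mixing (with some gap $n\in\mathbb N$) if and only if $X$ is uniformly avo for the family $\mathcal P(G\setminus\{e\})$ of all subsets of $G\setminus\{e\}$.
   Context: $G$ carries a finite generating set and the left-invariant word metric $d$; $\mathcal B_n=\{g: d(e,g)\le n\}$; $d(U,V)=\min\{d(u,v):u\in U,v\in V\}$. $A$ is a finite alphabet, $G$ acts on $A^G$ by $(gx)_h=x_{g^{-1}h}$, and a subshift is a closed $G$-invariant $X\subset A^G$. Write $x|C$ for restriction, $X|C=\{x|C:x\in X\}$. For a pattern (configuration) $P\in A^D$, $P\sqsubset X$ means that $P$ occurs in $X$, equivalently (by shift-invariance) $P\in X|D$. $\sqcup$ denotes union of patterns; $a^e$ is the pattern with domain $\{e\}$ and value $a$. $X$ satisfies topological strong spatial mixing with gap $n$ if for all pairwise disjoint finite $U,V,S\subset G$ with $d(U,V)\ge n$ and all $u\in A^U,v\in A^V,s\in A^S$: $u\sqcup s\sqsubset X$ and $s\sqcup v\sqsubset X$ imply $u\sqcup s\sqcup v\sqsubset X$. $X$ is uniformly avo for a family $\mathcal C$ of subsets of $G\setminus\{e\}$ if there is $r\in\mathbb N$ such that for every $C\in\mathcal C$, with $B=C\cap\mathcal B_r$, for all $x\in X|C$ and $a\in A$: $(x|B)\sqcup a^e\sqsubset X\iff x\sqcup a^e\sqsubset X$. *)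

theory Defs
  imports
    "HOL-Algebra.Generated_Groups"
    "HOL-Analysis.Analysis"
    "HOL-Library.Extended_Nat"
begin

definition word_length :: "('g, 'm) monoid_scheme \<Rightarrow> 'g set \<Rightarrow> 'g \<Rightarrow> nat" where
  "word_length G T g =
     (LEAST k. \<exists>ws. set ws \<subseteq> T \<union> m_inv G ` T \<and> length ws = k \<and>
                    foldr (\<otimes>\<^bsub>G\<^esub>) ws \<one>\<^bsub>G\<^esub> = g)"

definition word_dist :: "('g, 'm) monoid_scheme \<Rightarrow> 'g set \<Rightarrow> 'g \<Rightarrow> 'g \<Rightarrow> nat" where
  "word_dist G T g h = word_length G T (m_inv G g \<otimes>\<^bsub>G\<^esub> h)"

definition word_ball :: "('g, 'm) monoid_scheme \<Rightarrow> 'g set \<Rightarrow> nat \<Rightarrow> 'g set" where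
  "word_ball G T n = {g \<in> carrier G. word_dist G T \<one>\<^bsub>G\<^esub> g \<le> n}"

text \<open>The distance of two sets is extended-valued: it is infinite if one of them is empty, and
  otherwise the infimum is a minimum.\<close>

definition set_dist :: "('g, 'm) monoid_scheme \<Rightarrow> 'g set \<Rightarrow> 'g set \<Rightarrow> 'g set \<Rightarrow> enat" where
  "set_dist G T U V = (INF u\<in>U. INF v\<in>V. enat (word_dist G T u v))"

text \<open>Configurations and patterns with domain \<open>D\<close> are the extensional functions in
  \<open>D \<rightarrow>\<^sub>E A\<close>, where \<open>D = carrier G\<close> for configurations. The restriction of \<open>x\<close> to \<open>D\<close> is
  \<open>restrict x D\<close>. The union of patterns \<open>u\<close>, \<open>v\<close> with disjoint domains \<open>U\<close>, \<open>V\<close> is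
  \<open>merge U V (u, v)\<close>, which lies in \<open>(U \<union> V) \<rightarrow>\<^sub>E A\<close>.\<close>

definition shift :: "('g, 'm) monoid_scheme \<Rightarrow> 'g \<Rightarrow> ('g \<Rightarrow> 'a) \<Rightarrow> 'g \<Rightarrow> 'a" where
  "shift G g x = (\<lambda>h\<in>carrier G. x (m_inv G g \<otimes>\<^bsub>G\<^esub> h))"

definition subshift :: "('g, 'm) monoid_scheme \<Rightarrow> 'a set \<Rightarrow> ('g \<Rightarrow> 'a) set \<Rightarrow> bool" where
  "subshift G A X \<longleftrightarrow>
     closedin (product_topology (\<lambda>_. discrete_topology A) (carrier G)) X \<and>
     (\<forall>g\<in>carrier G. \<forall>x\<in>X. shift G g x \<in> X)"

definition restrictions :: "('g \<Rightarrow> 'a) set \<Rightarrow> 'g set \<Rightarrow> ('g \<Rightarrow> 'a) set" where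
  "restrictions X D = (\<lambda>x. restrict x D) ` X"

text \<open>The pattern \<open>P\<close> with domain \<open>D\<close> is seen somewhere in an element of \<open>X\<close>. The domain is an
  explicit argument because it cannot be read off from an extensional function.\<close>

definition occurs ::
  "('g, 'm) monoid_scheme \<Rightarrow> ('g \<Rightarrow> 'a) set \<Rightarrow> 'g set \<Rightarrow> ('g \<Rightarrow> 'a) \<Rightarrow> bool" where
  "occurs G X D P \<longleftrightarrow> (\<exists>x\<in>X. \<exists>g\<in>carrier G. restrict (shift G g x) D = P)"

lemma occurs_iff_restrictions:
  assumes "group G" and "subshift G A X"
  shows "occurs G X D P \<longleftrightarrow> P \<in> restrictions X D"
proof -
  interpret group G by fact
  have X: "X \<subseteq> carrier G \<rightarrow>\<^sub>E A"
    using assms(2) closedin_subset unfolding subshift_def by fastforce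
  have one: "shift G \<one>\<^bsub>G\<^esub> x = x" if "x \<in> X" for x
  proof
    fix h
    have "x \<in> extensional (carrier G)"
      using X that by (auto simp: PiE_def)
    then show "shift G \<one>\<^bsub>G\<^esub> x h = x h"
      by (cases "h \<in> carrier G") (simp_all add: shift_def extensional_def)
  qed
  show ?thesis
  proof
    assume "occurs G X D P"
    then show "P \<in> restrictions X D"
      using assms(2) unfolding occurs_def restrictions_def subshift_def by blast
  next
    assume "P \<in> restrictions X D"
    then obtain x where "x \<in> X" "P = restrict x D"
      unfolding restrictions_def by blast
    then show "occurs G X D P"
      unfolding occurs_def using one one_closed by metis
  qed
qed

definition topological_strong_spatial_mixing ::
  "('g, 'm) monoid_scheme \<Rightarrow> 'g set \<Rightarrow> 'a set \<Rightarrow> ('g \<Rightarrow> 'a) set \<Rightarrow> nat \<Rightarrow> bool" where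
  "topological_strong_spatial_mixing G T A X n \<longleftrightarrow>
     (\<forall>U V S. U \<subseteq> carrier G \<longrightarrow> V \<subseteq> carrier G \<longrightarrow> S \<subseteq> carrier G \<longrightarrow>
        finite U \<longrightarrow> finite V \<longrightarrow> finite S \<longrightarrow>
        U \<inter> V = {} \<longrightarrow> U \<inter> S = {} \<longrightarrow> V \<inter> S = {} \<longrightarrow>
        enat n \<le> set_dist G T U V \<longrightarrow>
        (\<forall>u \<in> U \<rightarrow>\<^sub>E A. \<forall>v \<in> V \<rightarrow>\<^sub>E A. \<forall>s \<in> S \<rightarrow>\<^sub>E A.
           occurs G X (U \<union> S) (merge U S (u, s)) \<longrightarrow>
           occurs G X (S \<union> V) (merge S V (s, v)) \<longrightarrow>
           occurs G X (U \<union> S \<union> V) (merge (U \<union> S) V (merge U S (u, s), v))))"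

definition uniformly_avo ::
  "('g, 'm) monoid_scheme \<Rightarrow> 'g set \<Rightarrow> 'a set \<Rightarrow> ('g \<Rightarrow> 'a) set \<Rightarrow> 'g set set \<Rightarrow> bool" where
  "uniformly_avo G T A X \<C> \<longleftrightarrow>
     (\<exists>r. \<forall>C\<in>\<C>. let B = C \<inter> word_ball G T r; e = \<one>\<^bsub>G\<^esub> in
        \<forall>x\<in>restrictions X C. \<forall>a\<in>A.
          occurs G X (B \<union> {e}) (merge B {e} (restrict x B, \<lambda>_\<in>{e}. a)) \<longleftrightarrow>
          occurs G X (C \<union> {e}) (merge C {e} (x, \<lambda>_\<in>{e}. a)))"

end

theory Submission
  imports Defs
begin

text \<open>Both properties say that two points \<open>x\<close>, \<open>y\<close> of \<open>X\<close> which agree on some set can be glued to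
  a point of \<open>X\<close> that follows \<open>x\<close> on one set and \<open>y\<close> on another. For strong spatial mixing,
  \<open>x\<close> and \<open>y\<close> agree on \<open>S\<close> and the glued point follows \<open>x\<close> on \<open>U\<close> and \<open>y\<close> on \<open>V\<close>, where all
  sets are finite (\<open>tssm_iff_gluing\<close>); for the avo property, they agree on the part of \<open>C\<close> in a
  ball around the identity, and the glued point follows \<open>x\<close> at the identity and \<open>y\<close> on \<open>C\<close>, which
  may be infinite (\<open>avo_iff_gluing\<close>).

  From mixing with gap \<open>n\<close>, the avo property follows with radius \<open>n\<close>: take \<open>U\<close> to be the singleton
  of the identity, \<open>S = C \<inter> \<B>\<^sub>n\<close>, which is finite as balls are finite, and let \<open>V\<close> range over the
  finite subsets of \<open>C - \<B>\<^sub>n\<close>. As the alphabet is finite, \<open>X\<close> is compact, so these local gluings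
  yield one on all of \<open>C\<close> (\<open>extends_if_finitely_extends\<close>).

  Conversely, the avo property with radius \<open>r\<close> gives mixing with gap \<open>r + 1\<close>, by adding the
  elements of \<open>U\<close> one at a time (\<open>finite_gluing_if_avo\<close>): shift the new element \<open>g\<close> to the
  identity; then \<open>V\<close> lies outside the ball of radius \<open>r\<close>, so within that ball the point built so
  far follows \<open>x\<close>, and the avo property permits the value of \<open>x\<close> at \<open>g\<close>.\<close>

section \<open>Gluing forms of the two properties\<close>

lemma subshift_subset:
  assumes "subshift G A X"
  shows "X \<subseteq> carrier G \<rightarrow>\<^sub>E A"
  using assms closedin_subset unfolding subshift_def by fastforce

lemma occurs_merge_iff:
  assumes "group G" and "subshift G A X" and "I \<inter> J = {}"
  shows "occurs G X (I \<union> J) (merge I J (u, v)) \<longleftrightarrow>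
         (\<exists>x\<in>X. (\<forall>h\<in>I. x h = u h) \<and> (\<forall>h\<in>J. x h = v h))"
proof -
  have "merge I J (u, v) = restrict x (I \<union> J) \<longleftrightarrow>
        (\<forall>h\<in>I. x h = u h) \<and> (\<forall>h\<in>J. x h = v h)" for x
    using assms(3) by (auto simp: fun_eq_iff merge_def)
  then show ?thesis
    by (simp only: occurs_iff_restrictions[OF assms(1,2)] restrictions_def image_iff)
qed

text \<open>The points \<open>x\<close> and \<open>y\<close> are those in which the patterns \<open>u \<squnion> s\<close> and \<open>s \<squnion> v\<close> occur; that
  both patterns contain \<open>s\<close> is the agreement on \<open>S\<close>.\<close>

lemma tssm_iff_gluing:
  assumes "group G" and "subshift G A X"
  shows "topological_strong_spatial_mixing G T A X n \<longleftrightarrow>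
     (\<forall>U V S. U \<subseteq> carrier G \<longrightarrow> V \<subseteq> carrier G \<longrightarrow> S \<subseteq> carrier G \<longrightarrow>
        finite U \<longrightarrow> finite V \<longrightarrow> finite S \<longrightarrow>
        U \<inter> V = {} \<longrightarrow> U \<inter> S = {} \<longrightarrow> V \<inter> S = {} \<longrightarrow>
        (\<forall>u\<in>U. \<forall>v\<in>V. n \<le> word_dist G T u v) \<longrightarrow>
        (\<forall>x\<in>X. \<forall>y\<in>X. (\<forall>h\<in>S. x h = y h) \<longrightarrow>
           (\<exists>z\<in>X. (\<forall>h\<in>U \<union> S. z h = x h) \<and> (\<forall>h\<in>V. z h = y h))))"
proof -
  have dist: "enat n \<le> set_dist G T U V \<longleftrightarrow> (\<forall>u\<in>U. \<forall>v\<in>V. n \<le> word_dist G T u v)" for U V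
    by (simp add: set_dist_def le_INF_iff)
  have patterns:
    "(\<forall>u \<in> U \<rightarrow>\<^sub>E A. \<forall>v \<in> V \<rightarrow>\<^sub>E A. \<forall>s \<in> S \<rightarrow>\<^sub>E A.
           occurs G X (U \<union> S) (merge U S (u, s)) \<longrightarrow>
           occurs G X (S \<union> V) (merge S V (s, v)) \<longrightarrow>
           occurs G X (U \<union> S \<union> V) (merge (U \<union> S) V (merge U S (u, s), v))) \<longleftrightarrow>
     (\<forall>x\<in>X. \<forall>y\<in>X. (\<forall>h\<in>S. x h = y h) \<longrightarrow>
           (\<exists>z\<in>X. (\<forall>h\<in>U \<union> S. z h = x h) \<and> (\<forall>h\<in>V. z h = y h)))" (is "?L \<longleftrightarrow> ?R")
    if sub: "U \<subseteq> carrier G" "V \<subseteq> carrier G" "S \<subseteq> carrier G"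
      and disj: "U \<inter> V = {}" "U \<inter> S = {}" "V \<inter> S = {}" for U V S
  proof -
    have disj': "S \<inter> V = {}" "(U \<union> S) \<inter> V = {}"
      using disj by auto
    note occ = occurs_merge_iff[OF assms disj(2)] occurs_merge_iff[OF assms disj'(1)]
      occurs_merge_iff[OF assms disj'(2)]
    have merge: "(\<forall>h\<in>U \<union> S. z h = merge U S (u, s) h) \<longleftrightarrow>
        (\<forall>h\<in>U. z h = u h) \<and> (\<forall>h\<in>S. z h = s h)" for z u s
      using disj(2) by (auto simp: merge_def)
    show ?thesis
    proof
      assume L: ?L
      show ?R
      proof (intro ballI impI)
        fix x y assume x: "x \<in> X" and y: "y \<in> X" and eq: "\<forall>h\<in>S. x h = y h"
        have "\<exists>z\<in>X. ((\<forall>h\<in>U. z h = restrict x U h) \<and> (\<forall>h\<in>S. z h = restrict x S h)) \<and>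
            (\<forall>h\<in>V. z h = restrict y V h)"
        proof (rule L[unfolded occ merge, THEN bspec, THEN bspec, THEN bspec, THEN mp, THEN mp])
          show "restrict x U \<in> U \<rightarrow>\<^sub>E A" "restrict y V \<in> V \<rightarrow>\<^sub>E A" "restrict x S \<in> S \<rightarrow>\<^sub>E A"
            using subshift_subset[OF assms(2)] x y sub by (auto simp: PiE_iff subset_iff)
          show "\<exists>z\<in>X. (\<forall>h\<in>U. z h = restrict x U h) \<and> (\<forall>h\<in>S. z h = restrict x S h)"
            using x by (intro bexI[of _ x]) auto
          show "\<exists>z\<in>X. (\<forall>h\<in>S. z h = restrict x S h) \<and> (\<forall>h\<in>V. z h = restrict y V h)"
            using y eq by (intro bexI[of _ y]) auto
        qed
        then show "\<exists>z\<in>X. (\<forall>h\<in>U \<union> S. z h = x h) \<and> (\<forall>h\<in>V. z h = y h)"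
          by (simp add: ball_Un)
      qed
    next
      assume R: ?R
      show ?L
        unfolding occ merge
      proof (intro ballI impI)
        fix u v s
        assume "\<exists>x\<in>X. (\<forall>h\<in>U. x h = u h) \<and> (\<forall>h\<in>S. x h = s h)"
          and "\<exists>x\<in>X. (\<forall>h\<in>S. x h = s h) \<and> (\<forall>h\<in>V. x h = v h)"
        then obtain x y where xy: "x \<in> X" "y \<in> X" "\<forall>h\<in>U. x h = u h" "\<forall>h\<in>S. x h = s h"
            "\<forall>h\<in>S. y h = s h" "\<forall>h\<in>V. y h = v h"
          by blast
        with R[rule_format, OF xy(1,2)]
        show "\<exists>z\<in>X. ((\<forall>h\<in>U. z h = u h) \<and> (\<forall>h\<in>S. z h = s h)) \<and> (\<forall>h\<in>V. z h = v h)"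
          by (metis Un_iff)
      qed
    qed
  qed
  show ?thesis
    unfolding topological_strong_spatial_mixing_def dist
    by (intro iff_allI imp_cong[OF refl]) (rule patterns; assumption)
qed

text \<open>The point \<open>y\<close> extends the pattern on \<open>C\<close>, and \<open>x\<close> is one in which the local pattern occurs
  together with the symbol at the identity. Only one direction of the equivalence in the
  definition has content: a pattern on \<open>C\<close> and the identity can always be restricted.\<close>

lemma avo_iff_gluing:
  fixes G (structure)
  assumes "group G" and "subshift G A X" and "\<And>C. C \<in> \<C> \<Longrightarrow> \<one> \<notin> C"
  shows "uniformly_avo G T A X \<C> \<longleftrightarrow>
     (\<exists>r. \<forall>C\<in>\<C>. \<forall>x\<in>X. \<forall>y\<in>X. (\<forall>h\<in>C \<inter> word_ball G T r. x h = y h) \<longrightarrow>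
        (\<exists>z\<in>X. z \<one> = x \<one> \<and> (\<forall>h\<in>C. z h = y h)))"
proof -
  interpret group G by fact
  have gluing: "(\<forall>p\<in>restrictions X C. \<forall>a\<in>A.
          occurs G X (B \<union> {\<one>}) (merge B {\<one>} (restrict p B, \<lambda>_\<in>{\<one>}. a)) \<longleftrightarrow>
          occurs G X (C \<union> {\<one>}) (merge C {\<one>} (p, \<lambda>_\<in>{\<one>}. a))) \<longleftrightarrow>
     (\<forall>x\<in>X. \<forall>y\<in>X. (\<forall>h\<in>B. x h = y h) \<longrightarrow> (\<exists>z\<in>X. z \<one> = x \<one> \<and> (\<forall>h\<in>C. z h = y h)))"
    (is "?L \<longleftrightarrow> ?R")
    if "C \<in> \<C>" and BC: "B \<subseteq> C" for B C
  proof -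
    have disj: "C \<inter> {\<one>} = {}" "B \<inter> {\<one>} = {}"
      using assms(3) that by auto
    note occ = occurs_merge_iff[OF assms(1,2) disj(1)] occurs_merge_iff[OF assms(1,2) disj(2)]
    have "?L \<longleftrightarrow> (\<forall>y\<in>X. \<forall>a\<in>A. (\<exists>x\<in>X. (\<forall>h\<in>B. x h = y h) \<and> x \<one> = a) \<longleftrightarrow>
        (\<exists>z\<in>X. (\<forall>h\<in>C. z h = y h) \<and> z \<one> = a))"
    proof -
      have "(\<forall>h\<in>B. x h = restrict (restrict y C) B h) \<longleftrightarrow> (\<forall>h\<in>B. x h = y h)" for x y :: "'a \<Rightarrow> 'c"
        using BC by auto
      then show ?thesis
        unfolding occ restrictions_def by simp
    qed
    also have "\<dots> \<longleftrightarrow> ?R" (is "?M \<longleftrightarrow> _")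
    proof -
      have val: "x \<one> \<in> A" if "x \<in> X" for x
        using subshift_subset[OF assms(2)] that by (auto simp: PiE_iff)
      show ?thesis
      proof
        assume M: ?M
        show ?R
        proof (intro ballI impI)
          fix x y assume "x \<in> X" "y \<in> X" "\<forall>h\<in>B. x h = y h"
          with M[rule_format, OF \<open>y \<in> X\<close> val[OF \<open>x \<in> X\<close>]]
          show "\<exists>z\<in>X. z \<one> = x \<one> \<and> (\<forall>h\<in>C. z h = y h)"
            by blast
        qed
      next
        assume R: ?R
        show ?M
        proof (intro ballI iffI)
          fix y a assume "y \<in> X" "\<exists>x\<in>X. (\<forall>h\<in>B. x h = y h) \<and> x \<one> = a"
          with R show "\<exists>z\<in>X. (\<forall>h\<in>C. z h = y h) \<and> z \<one> = a"
            by blast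
        next
          fix y a assume "\<exists>z\<in>X. (\<forall>h\<in>C. z h = y h) \<and> z \<one> = a"
          with BC show "\<exists>x\<in>X. (\<forall>h\<in>B. x h = y h) \<and> x \<one> = a"
            by blast
        qed
      qed
    qed
    finally show ?thesis .
  qed
  show ?thesis
    unfolding uniformly_avo_def Let_def
    by (intro iff_exI ball_cong[OF refl] gluing Int_lower1)
qed

section \<open>Finiteness of balls\<close>

lemma (in group) foldr_mult_append:
  assumes "set xs \<subseteq> carrier G" and "set ys \<subseteq> carrier G"
  shows "foldr (\<otimes>) (xs @ ys) \<one> = foldr (\<otimes>) xs \<one> \<otimes> foldr (\<otimes>) ys \<one>"
proof -
  have closed: "foldr (\<otimes>) zs \<one> \<in> carrier G" if "set zs \<subseteq> carrier G" for zs
    using that by (induction zs) auto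
  show ?thesis
    using assms(1) by (induction xs) (auto simp: closed assms(2) m_assoc)
qed

lemma (in group) word_if_generate:
  assumes "T \<subseteq> carrier G" and "g \<in> generate G T"
  shows "\<exists>ws. set ws \<subseteq> T \<union> m_inv G ` T \<and> foldr (\<otimes>) ws \<one> = g"
  using assms(2)
proof induction
  case one
  show ?case by (rule exI[of _ "[]"]) simp
next
  case (incl h)
  then show ?case using assms(1) by (intro exI[of _ "[h]"]) auto
next
  case (inv h)
  then show ?case using assms(1) by (intro exI[of _ "[inv h]"]) auto
next
  case (eng h1 h2)
  then obtain ws1 ws2 where
    ws: "set ws1 \<subseteq> T \<union> m_inv G ` T" "foldr (\<otimes>) ws1 \<one> = h1"
        "set ws2 \<subseteq> T \<union> m_inv G ` T" "foldr (\<otimes>) ws2 \<one> = h2"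
    by blast
  have "T \<union> m_inv G ` T \<subseteq> carrier G"
    using assms(1) by auto
  then have "foldr (\<otimes>) (ws1 @ ws2) \<one> = h1 \<otimes> h2"
    using ws foldr_mult_append[of ws1 ws2] by auto
  then show ?case
    using ws by (intro exI[of _ "ws1 @ ws2"]) auto
qed

text \<open>The word length is a least element only where a word exists, so generation by \<open>T\<close> is what
  makes every element of a ball the product of a short word.\<close>

lemma (in group) finite_word_ball:
  assumes "finite T" and "T \<subseteq> carrier G" and "generate G T = carrier G"
  shows "finite (word_ball G T n)"
proof -
  define words where "words = {ws. set ws \<subseteq> T \<union> m_inv G ` T \<and> length ws \<le> n}"
  have "word_ball G T n \<subseteq> (\<lambda>ws. foldr (\<otimes>) ws \<one>) ` words"
  proof
    fix g assume "g \<in> word_ball G T n"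
    then have g: "g \<in> carrier G" "word_length G T g \<le> n"
      by (auto simp: word_ball_def word_dist_def)
    have "\<exists>k ws. set ws \<subseteq> T \<union> m_inv G ` T \<and> length ws = k \<and> foldr (\<otimes>) ws \<one> = g"
      using word_if_generate[OF assms(2), of g] g(1) assms(3) by blast
    from LeastI_ex[OF this]
    obtain ws where "set ws \<subseteq> T \<union> m_inv G ` T" "length ws = word_length G T g"
        "foldr (\<otimes>) ws \<one> = g"
      unfolding word_length_def by blast
    with g(2) show "g \<in> (\<lambda>ws. foldr (\<otimes>) ws \<one>) ` words"
      unfolding words_def by force
  qed
  moreover have "finite words"
    unfolding words_def using assms(1) by (intro finite_lists_length_le) simp
  ultimately show ?thesis
    by (meson finite_imageI finite_subset)
qed

section \<open>From mixing to the avo property\<close>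

text \<open>Compactness: prescribing the value at one element of \<open>D\<close> cuts out a closed subset of the
  compact space \<open>X\<close>, and by hypothesis these closed sets have the finite intersection property.\<close>

lemma extends_if_finitely_extends:
  assumes "finite A" and "closedin (product_topology (\<lambda>_. discrete_topology A) I) X"
    and "D \<subseteq> I"
    and fin: "\<And>F. finite F \<Longrightarrow> F \<subseteq> D \<Longrightarrow> \<exists>x\<in>X. \<forall>h\<in>F. x h = p h"
  shows "\<exists>x\<in>X. \<forall>h\<in>D. x h = p h"
proof -
  let ?P = "product_topology (\<lambda>_. discrete_topology A) I"
  have X: "X \<subseteq> topspace ?P"
    using assms(2) closedin_subset by blast
  have "compact_space ?P"
    using assms(1) by (simp add: compact_space_product_topology compact_space_discrete_topology)
  then have compact: "compactin ?P X"
    using assms(2) closedin_compact_space by blast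
  define K where "K h = {x \<in> topspace ?P. x h \<in> {p h} \<inter> A}" for h
  have "closedin ?P (K h)" if "h \<in> D" for h
    unfolding K_def
  proof (rule closedin_continuous_map_preimage)
    show "continuous_map ?P (discrete_topology A) (\<lambda>x. x h)"
      using that assms(3) by (intro continuous_map_product_projection) auto
  qed simp
  moreover have "X \<inter> \<Inter>\<F> \<noteq> {}" if \<F>: "finite \<F>" "\<F> \<subseteq> K ` D" for \<F>
  proof -
    obtain F where F: "F \<subseteq> D" "finite F" "\<F> = K ` F"
      using finite_subset_image[OF \<F>] by blast
    obtain x where "x \<in> X" "\<forall>h\<in>F. x h = p h"
      using fin F by blast
    moreover have "x h \<in> A" if "h \<in> F" for h
      using X \<open>x \<in> X\<close> F(1) assms(3) that by (auto simp: PiE_iff subset_iff)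
    ultimately have "x \<in> X \<inter> \<Inter>\<F>"
      using X F(3) by (auto simp: K_def)
    then show ?thesis
      by blast
  qed
  ultimately have "X \<inter> \<Inter>(K ` D) \<noteq> {}"
    using compact unfolding compactin_fip by blast
  then show ?thesis
    by (auto simp: K_def)
qed

text \<open>Mixing realises each finite part \<open>F\<close> of the wanted pattern: within the ball the pattern is
  that of \<open>x\<close>, so the part of \<open>C\<close> in the ball can serve as \<open>S\<close>, and the rest of \<open>F\<close> is far from the identity.\<close>

lemma avo_gluing_if_tssm:
  fixes G (structure)
  assumes "group G" and T: "finite T" "T \<subseteq> carrier G" "generate G T = carrier G"
    and "finite A" and X: "subshift G A X"
    and tssm: "topological_strong_spatial_mixing G T A X n"
    and C: "C \<subseteq> carrier G - {\<one>}" and x: "x \<in> X" and y: "y \<in> X"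
    and agree: "\<forall>h\<in>C \<inter> word_ball G T n. x h = y h"
  shows "\<exists>z\<in>X. z \<one> = x \<one> \<and> (\<forall>h\<in>C. z h = y h)"
proof -
  interpret group G by fact
  define p where "p = y(\<one> := x \<one>)"
  have "\<exists>z\<in>X. \<forall>h\<in>insert \<one> C. z h = p h"
  proof (rule extends_if_finitely_extends[OF \<open>finite A\<close>])
    show "closedin (product_topology (\<lambda>_. discrete_topology A) (carrier G)) X"
      using X unfolding subshift_def by blast
    show "insert \<one> C \<subseteq> carrier G"
      using C by auto
    fix F assume F: "finite F" "F \<subseteq> insert \<one> C"
    define S where "S = C \<inter> word_ball G T n"
    define V where "V = F - {\<one>} - word_ball G T n"
    have "finite S"
      unfolding S_def using finite_word_ball[OF T] by blast
    moreover have "n \<le> word_dist G T \<one> v" if "v \<in> V" for v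
      using that F(2) C unfolding V_def word_ball_def by auto
    ultimately have "\<exists>z\<in>X. (\<forall>h\<in>{\<one>} \<union> S. z h = x h) \<and> (\<forall>h\<in>V. z h = y h)"
      using F C x y agree
      by (intro tssm[unfolded tssm_iff_gluing[OF \<open>group G\<close> X], rule_format])
        (auto simp: S_def V_def)
    then obtain z where z: "z \<in> X" "\<forall>h\<in>{\<one>} \<union> S. z h = x h" "\<forall>h\<in>V. z h = y h"
      by blast
    have "z h = p h" if "h \<in> F" for h
      using z that F(2) agree unfolding p_def S_def V_def by (cases "h \<in> word_ball G T n") auto
    with z(1) show "\<exists>z\<in>X. \<forall>h\<in>F. z h = p h"
      by blast
  qed
  moreover have "p \<one> = x \<one>" "\<forall>h\<in>C. p h = y h"
    using C unfolding p_def by auto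
  ultimately show ?thesis
    by (metis insert_iff)
qed

section \<open>From the avo property to mixing\<close>

text \<open>Invariance of \<open>X\<close> and of the metric move the distinguished point from the identity to any
  \<open>g\<close>.\<close>

lemma avo_gluing_at:
  fixes G (structure)
  assumes "group G" and X: "subshift G A X"
    and avo: "\<forall>C\<in>Pow (carrier G - {\<one>}). \<forall>x\<in>X. \<forall>y\<in>X.
        (\<forall>h\<in>C \<inter> word_ball G T r. x h = y h) \<longrightarrow> (\<exists>z\<in>X. z \<one> = x \<one> \<and> (\<forall>h\<in>C. z h = y h))"
    and g: "g \<in> carrier G" and D: "D \<subseteq> carrier G - {g}" and x: "x \<in> X" and y: "y \<in> X"
    and agree: "\<And>h. h \<in> D \<Longrightarrow> word_dist G T g h \<le> r \<Longrightarrow> x h = y h"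
  shows "\<exists>z\<in>X. z g = x g \<and> (\<forall>h\<in>D. z h = y h)"
proof -
  interpret group G by fact
  define C where "C = {c \<in> carrier G. g \<otimes> c \<in> D}"
  have inv: "shift G k w \<in> X" if "k \<in> carrier G" "w \<in> X" for k w
    using X that unfolding subshift_def by blast
  have "\<exists>w\<in>X. w \<one> = shift G (inv g) x \<one> \<and> (\<forall>h\<in>C. w h = shift G (inv g) y h)"
  proof (rule avo[THEN bspec, THEN bspec, THEN bspec, THEN mp])
    show "C \<in> Pow (carrier G - {\<one>})"
      using D g unfolding C_def by auto
    show "\<forall>h\<in>C \<inter> word_ball G T r. shift G (inv g) x h = shift G (inv g) y h"
    proof
      fix c assume c: "c \<in> C \<inter> word_ball G T r"
      then have "word_dist G T g (g \<otimes> c) \<le> r"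
        using g by (auto simp: C_def word_ball_def word_dist_def m_assoc[symmetric])
      with c g agree show "shift G (inv g) x c = shift G (inv g) y c"
        by (auto simp: C_def shift_def)
    qed
  qed (use inv x y g in auto)
  then obtain w where w: "w \<in> X" "w \<one> = x g" "\<And>c. c \<in> C \<Longrightarrow> w c = y (g \<otimes> c)"
    using g by (auto simp: shift_def C_def)
  have "shift G g w h = y h" if "h \<in> D" for h
  proof -
    have "h \<in> carrier G" "g \<otimes> (inv g \<otimes> h) = h"
      using that D g by (auto simp: m_assoc[symmetric])
    then show ?thesis
      using that g w(3)[of "inv g \<otimes> h"] by (simp add: shift_def C_def)
  qed
  moreover have "shift G g w g = x g"
    using g w(2) by (simp add: shift_def)
  ultimately show ?thesis
    using inv g w(1) by blast
qed

text \<open>Induction on \<open>U\<close>: the point built for the smaller set agrees with \<open>x\<close> on all of its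
  prescribed domain within distance \<open>r\<close> of the new element, because \<open>V\<close> is farther away.\<close>

lemma finite_gluing_if_avo:
  fixes G (structure)
  assumes "group G" and X: "subshift G A X"
    and avo: "\<forall>C\<in>Pow (carrier G - {\<one>}). \<forall>x\<in>X. \<forall>y\<in>X.
        (\<forall>h\<in>C \<inter> word_ball G T r. x h = y h) \<longrightarrow> (\<exists>z\<in>X. z \<one> = x \<one> \<and> (\<forall>h\<in>C. z h = y h))"
    and "finite U" and "U \<subseteq> carrier G" and V: "V \<subseteq> carrier G" and S: "S \<subseteq> carrier G"
    and "U \<inter> V = {}" and "U \<inter> S = {}"
    and "\<forall>u\<in>U. \<forall>v\<in>V. r < word_dist G T u v"
    and x: "x \<in> X" and y: "y \<in> X" and agree: "\<forall>h\<in>S. x h = y h"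
  shows "\<exists>z\<in>X. (\<forall>h\<in>U \<union> S. z h = x h) \<and> (\<forall>h\<in>V. z h = y h)"
  using \<open>finite U\<close> \<open>U \<subseteq> carrier G\<close> \<open>U \<inter> V = {}\<close> \<open>U \<inter> S = {}\<close>
    \<open>\<forall>u\<in>U. \<forall>v\<in>V. r < word_dist G T u v\<close>
proof induction
  case empty
  then show ?case using y agree by auto
next
  case (insert g U)
  then obtain z where z: "z \<in> X" "\<forall>h\<in>U \<union> S. z h = x h" "\<forall>h\<in>V. z h = y h"
    by auto
  have "\<exists>w\<in>X. w g = x g \<and> (\<forall>h\<in>U \<union> S \<union> V. w h = z h)"
  proof (rule avo_gluing_at[OF \<open>group G\<close> X avo])
    show "U \<union> S \<union> V \<subseteq> carrier G - {g}"
      using insert V S by auto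
    fix h assume h: "h \<in> U \<union> S \<union> V" "word_dist G T g h \<le> r"
    then have "h \<notin> V"
      using insert.prems(4) by force
    with h z show "x h = z h"
      by auto
  qed (use insert.prems x z in auto)
  then show ?case
    using z by (smt (verit) Un_iff insert_iff)
qed

section \<open>The equivalence\<close>

theorem theorem4p9:
  fixes G :: "('g, 'm) monoid_scheme" and T :: "'g set"
    and A :: "'a set" and X :: "('g \<Rightarrow> 'a) set"
  assumes "group G"
    and "finite T" and "T \<subseteq> carrier G" and "generate G T = carrier G"
    and "finite A"
    and "subshift G A X"
  shows "(\<exists>n. topological_strong_spatial_mixing G T A X n) \<longleftrightarrow>
         uniformly_avo G T A X (Pow (carrier G - {\<one>\<^bsub>G\<^esub>}))"
proof -
  have avo_iff: "uniformly_avo G T A X (Pow (carrier G - {\<one>\<^bsub>G\<^esub>})) \<longleftrightarrow>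
     (\<exists>r. \<forall>C\<in>Pow (carrier G - {\<one>\<^bsub>G\<^esub>}). \<forall>x\<in>X. \<forall>y\<in>X.
        (\<forall>h\<in>C \<inter> word_ball G T r. x h = y h) \<longrightarrow>
        (\<exists>z\<in>X. z \<one>\<^bsub>G\<^esub> = x \<one>\<^bsub>G\<^esub> \<and> (\<forall>h\<in>C. z h = y h)))"
    by (rule avo_iff_gluing[OF assms(1,6)]) blast
  show ?thesis
  proof
    assume "\<exists>n. topological_strong_spatial_mixing G T A X n"
    then obtain n where n: "topological_strong_spatial_mixing G T A X n" ..
    show "uniformly_avo G T A X (Pow (carrier G - {\<one>\<^bsub>G\<^esub>}))"
      unfolding avo_iff using avo_gluing_if_tssm[OF assms n] by blast
  next
    assume "uniformly_avo G T A X (Pow (carrier G - {\<one>\<^bsub>G\<^esub>}))"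
    then obtain r where r: "\<forall>C\<in>Pow (carrier G - {\<one>\<^bsub>G\<^esub>}). \<forall>x\<in>X. \<forall>y\<in>X.
        (\<forall>h\<in>C \<inter> word_ball G T r. x h = y h) \<longrightarrow>
        (\<exists>z\<in>X. z \<one>\<^bsub>G\<^esub> = x \<one>\<^bsub>G\<^esub> \<and> (\<forall>h\<in>C. z h = y h))"
      unfolding avo_iff ..
    \<comment> \<open>Balls are closed, so \<open>V\<close> avoids the ball of radius \<open>r\<close> only from distance \<open>r + 1\<close> on.\<close>
    have "topological_strong_spatial_mixing G T A X (Suc r)"
      unfolding tssm_iff_gluing[OF assms(1,6)] Suc_le_eq
      by (intro allI impI ballI) (rule finite_gluing_if_avo[OF assms(1,6) r]; assumption)
    then show "\<exists>n. topological_strong_spatial_mixing G T A X n" ..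
  qed
qed

end
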